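(* Let $n\ge 2$ and $A=[a_{ij}]\in\mathbb{C}^{n\times n}$. Then for every $i\in N=\{1,\dots,n\}$, \[ \Xi^{\{i\}}(A)=\bigcup_{j\in N\setminus\{i\}}\big(\mathcal{D}_{ij}(A)\setminus\mathcal{L}_{ij}(A)\big), \] so that $\bigcap_{i\in N}\Xi^{\{i\}}(A)=\Theta(A)$. Moreover, the set $\Xi(A)=\bigcap_{\emptyset\neq S\subseteq N}\Xi^S(A)$ satisfies \[ \sigma(A)\subseteq\Xi(A),\qquad \Xi(A)\subseteq\Theta(A),\qquad \Xi(A)\subseteq\Omega(A),\qquad \Xi(A)\subseteq C(A). \]
   Context: $\sigma(A)$ denotes the set of all eigenvalues of $A$. For $S\subseteq N$, $\overline{S}=N\setminus S$. For $i\in N$ and $T\subseteq N$ put $r_i^T=\sum_{j\in T\setminus\{i\}}|a_{ij}|$, and $r_i=\sum_{j\in N\setminus\{i\}}|a_{ij}|$. For a nonempty proper subset $S$ of $N$, and $i\in S$, $j\in\overline{S}$, define \[ W_{ij}^S(A)=\Big\{z\in\mathbb{C}: \max\{0,|z-a_{ii}|-r_i^S\}\cdot\max\{0,|z-a_{jj}|-r_j^{\overline{S}}\}\le r_i^{\overline{S}}\,r_j^S\Big\}, \] \[ \Psi_{ij}^S(A)=\Big\{z\in\mathbb{C}: \big(|z-a_{ii}|+r_i^S\big)\big(|z-a_{jj}|+r_j^{\overline{S}}\big)<\max\{0,2|a_{ij}|-r_i^{\overline{S}}\}\cdot\max\{0,2|a_{ji}|-r_j^S\}\Big\}, \] and $\Xi^{S}(A)=\bigcup_{i\in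 S,\,j\in\overline{S}}\big(W_{ij}^S(A)\setminus\Psi_{ij}^S(A)\big)$. For $S=N$ put $\Xi^N(A)=\Omega(A)$, where $\Omega(A)=\bigcup_{i\in N}\big(\Gamma_i(A)\setminus\Delta_i(A)\big)$ is the Geršgorin inclusion-exclusion set, with $\Gamma_i(A)=\{z\in\mathbb{C}:|z-a_{ii}|\le r_i\}$ and $\Delta_i(A)=\bigcup_{k\in N\setminus\{i\}}\{z\in\mathbb{C}:|z-a_{kk}|<2|a_{ki}|-r_k\}$. For $i\neq j$ let $r_j^i:=r_j-|a_{ji}|$ (here the superscript is an index, not a subset) and \[ \mathcal{D}_{ij}(A)=\{z\in\mathbb{C}:|z-a_{ii}|(|z-a_{jj}|-r_j^i)\le r_i|a_{ji}|\}, \] \[ \mathcal{L}_{ij}(A)=\{z\in\mathbb{C}:|z-a_{ii}|(|z-a_{jj}|+r_j^i)<(2|a_{ij}|-r_i)|a_{ji}|\}. \] The Dashnic-Zusmanovich inclusion-exclusion set is $\Theta(A)=\bigcap_{i\in N}\bigcup_{j\in N\setminus\{i\}}\big(\mathcal{D}_{ij}(A)\setminus\mathcal{L}_{ij}(A)\big)$. The CKV set is $C(A)=\bigcap_{\emptyset\neq S\subseteq N}C^S(A)$, where \[ C^S(A)=\Big(\bigcup_{i\in S}\Gamma_i^S(A)\Big)\cup\Big(\bigcup_{i\in S,\,j\in\overline{S}}V_{ij}^S(A)\Big), \] $\Gamma_i^S(A)=\{z\in\mathbb{C}:|z-a_{ii}|\le r_i^S\}$ and $V_{ij}^S(A)=\{z\in\mathbb{C}:(|z-a_{ii}|-r_i^S)(|z-a_{jj}|-r_j^{\overline{S}})\le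 r_i^{\overline{S}}r_j^S\}$ (for $S=N$ the second union is empty). *)

theory Defs
  imports "Jordan_Normal_Form.Spectral_Radius"
begin

(* Rows and columns are numbered from 0, as for all matrices of type mat, so the index set
   N = {1,...,n} becomes {0..<n}. *)
definition idx :: "complex mat \<Rightarrow> nat set" where
  "idx A = {0..<dim_row A}"

definition row_sum :: "complex mat \<Rightarrow> nat \<Rightarrow> real" where
  "row_sum A i = (\<Sum>j\<in>idx A - {i}. cmod (A $$ (i,j)))"

definition part_sum :: "complex mat \<Rightarrow> nat set \<Rightarrow> nat \<Rightarrow> real" where
  "part_sum A T i = (\<Sum>j\<in>T - {i}. cmod (A $$ (i,j)))"

definition W_set :: "complex mat \<Rightarrow> nat set \<Rightarrow> nat \<Rightarrow> nat \<Rightarrow> complex set" where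
  "W_set A S i j = {z.
     max 0 (cmod (z - A $$ (i,i)) - part_sum A S i)
       * max 0 (cmod (z - A $$ (j,j)) - part_sum A (idx A - S) j)
     \<le> part_sum A (idx A - S) i * part_sum A S j}"

definition Psi_set :: "complex mat \<Rightarrow> nat set \<Rightarrow> nat \<Rightarrow> nat \<Rightarrow> complex set" where
  "Psi_set A S i j = {z.
     (cmod (z - A $$ (i,i)) + part_sum A S i)
       * (cmod (z - A $$ (j,j)) + part_sum A (idx A - S) j)
     < max 0 (2 * cmod (A $$ (i,j)) - part_sum A (idx A - S) i)
       * max 0 (2 * cmod (A $$ (j,i)) - part_sum A S j)}"

definition Gamma_disk :: "complex mat \<Rightarrow> nat \<Rightarrow> complex set" where
  "Gamma_disk A i = {z. cmod (z - A $$ (i,i)) \<le> row_sum A i}"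

definition Delta_set :: "complex mat \<Rightarrow> nat \<Rightarrow> complex set" where
  "Delta_set A i = (\<Union>k\<in>idx A - {i}.
     {z. cmod (z - A $$ (k,k)) < 2 * cmod (A $$ (k,i)) - row_sum A k})"

(* Gersgorin inclusion-exclusion set *)
definition Omega_set :: "complex mat \<Rightarrow> complex set" where
  "Omega_set A = (\<Union>i\<in>idx A. Gamma_disk A i - Delta_set A i)"

definition Xi_part :: "complex mat \<Rightarrow> nat set \<Rightarrow> complex set" where
  "Xi_part A S =
     (if S = idx A then Omega_set A
      else (\<Union>i\<in>S. \<Union>j\<in>idx A - S. W_set A S i j - Psi_set A S i j))"

definition Xi_set :: "complex mat \<Rightarrow> complex set" where
  "Xi_set A = (\<Inter>S\<in>{S. S \<noteq> {} \<and> S \<subseteq> idx A}. Xi_part A S)"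

(* r_j^i, where the superscript i is an index to be left out of the row sum, unlike the
   subset T in r_i^T = part_sum A T i. *)
definition row_sum_without :: "complex mat \<Rightarrow> nat \<Rightarrow> nat \<Rightarrow> real" where
  "row_sum_without A j i = row_sum A j - cmod (A $$ (j,i))"

definition D_set :: "complex mat \<Rightarrow> nat \<Rightarrow> nat \<Rightarrow> complex set" where
  "D_set A i j = {z.
     cmod (z - A $$ (i,i)) * (cmod (z - A $$ (j,j)) - row_sum_without A j i)
     \<le> row_sum A i * cmod (A $$ (j,i))}"

definition L_set :: "complex mat \<Rightarrow> nat \<Rightarrow> nat \<Rightarrow> complex set" where
  "L_set A i j = {z.
     cmod (z - A $$ (i,i)) * (cmod (z - A $$ (j,j)) + row_sum_without A j i)
     < (2 * cmod (A $$ (i,j)) - row_sum A i) * cmod (A $$ (j,i))}"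

(* Dashnic-Zusmanovich inclusion-exclusion set *)
definition Theta_set :: "complex mat \<Rightarrow> complex set" where
  "Theta_set A = (\<Inter>i\<in>idx A. \<Union>j\<in>idx A - {i}. D_set A i j - L_set A i j)"

definition Gamma_part :: "complex mat \<Rightarrow> nat set \<Rightarrow> nat \<Rightarrow> complex set" where
  "Gamma_part A S i = {z. cmod (z - A $$ (i,i)) \<le> part_sum A S i}"

definition V_set :: "complex mat \<Rightarrow> nat set \<Rightarrow> nat \<Rightarrow> nat \<Rightarrow> complex set" where
  "V_set A S i j = {z.
     (cmod (z - A $$ (i,i)) - part_sum A S i)
       * (cmod (z - A $$ (j,j)) - part_sum A (idx A - S) j)
     \<le> part_sum A (idx A - S) i * part_sum A S j}"

definition CKV_part :: "complex mat \<Rightarrow> nat set \<Rightarrow> complex set" where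
  "CKV_part A S = (\<Union>i\<in>S. Gamma_part A S i) \<union> (\<Union>i\<in>S. \<Union>j\<in>idx A - S. V_set A S i j)"

definition CKV_set :: "complex mat \<Rightarrow> complex set" where
  "CKV_set A = (\<Inter>S\<in>{S. S \<noteq> {} \<and> S \<subseteq> idx A}. CKV_part A S)"

end

theory Submission
  imports Defs
begin

text \<open>Let \<open>x\<close> be an eigenvector for \<open>z\<close>, and let \<open>i\<close> and \<open>j\<close> maximise \<open>\<bar>x\<bar>\<close> on \<open>S\<close> and on its
  complement. Row \<open>i\<close> of \<open>A x = z x\<close> says that the terms \<open>(z - a\<^sub>i\<^sub>i) x\<^sub>i\<close> and \<open>a\<^sub>i\<^sub>l x\<^sub>l\<close> balance, so no
  modulus among them exceeds the sum of the others. Singling out the diagonal term bounds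
  \<open>\<bar>x\<^sub>i\<bar>\<close> by \<open>\<bar>x\<^sub>j\<bar>\<close>, and singling out the term of \<open>j\<close> bounds \<open>\<bar>x\<^sub>j\<bar>\<close> by \<open>\<bar>x\<^sub>i\<bar>\<close>; row \<open>j\<close> gives the
  converse bounds. Multiplying the two diagonal estimates puts \<open>z\<close> into the inclusion set,
  multiplying the two off-diagonal ones keeps it out of the exclusion set.\<close>

section \<open>Partial row sums and real inequalities\<close>

lemma part_sum_nonneg: "part_sum A T i \<ge> 0"
  unfolding part_sum_def by (simp add: sum_nonneg)

lemma part_sum_idx: "part_sum A (idx A) i = row_sum A i"
  unfolding part_sum_def row_sum_def ..

lemma part_sum_singleton: "i \<noteq> j \<Longrightarrow> part_sum A {i} j = cmod (A $$ (j,i))"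
  unfolding part_sum_def by simp

lemma part_sum_self: "part_sum A {i} i = 0"
  unfolding part_sum_def by simp

lemma part_sum_remove_self: "part_sum A (T - {i}) i = part_sum A T i"
  unfolding part_sum_def by simp

lemma part_sum_remove:
  assumes "i \<in> idx A" "i \<noteq> j"
  shows "part_sum A (idx A - {i}) j = row_sum_without A j i"
proof -
  have "idx A - {i} - {j} = idx A - {j} - {i}" by auto
  moreover have "i \<in> idx A - {j}" "finite (idx A - {j})"
    using assms by (auto simp: idx_def)
  ultimately show ?thesis
    unfolding part_sum_def row_sum_without_def row_sum_def by (simp add: sum_diff1)
qed

lemma sum_le_part_sum:
  assumes "\<And>l. l \<in> T \<Longrightarrow> cmod (v $ l) \<le> m"
  shows "(\<Sum>l\<in>T - {k}. cmod (A $$ (k,l)) * cmod (v $ l)) \<le> part_sum A T k * m"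
  unfolding part_sum_def sum_distrib_right
  using assms by (intro sum_mono mult_left_mono) auto

text \<open>Truncation turns a negative \<open>a\<close> into 0, where \<open>0 \<le> b\<close>
  suffices. This carries plain row estimates over to the truncated factors of \<open>W_set\<close>
  and \<open>Psi_set\<close>.\<close>

lemma max_zero_mult_le:
  fixes a b x :: real
  assumes "a * x \<le> b" "0 \<le> b"
  shows "max 0 a * x \<le> b"
  using assms by (simp add: max_def)

text \<open>The case distinction cannot be avoided: one of \<open>x\<close>, \<open>y\<close> may vanish, and then the product
  of the hypotheses carries no information.\<close>

lemma mult_le_mult_of_cross_bounds:
  fixes a b c d x y :: real
  assumes "a * x \<le> b * y" "c * y \<le> d * x"
    and "0 \<le> a" "0 \<le> b" "0 \<le> c" "0 \<le> d" "0 \<le> x" "0 \<le> y" and "x \<noteq> 0 \<or> y \<noteq> 0"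
  shows "a * c \<le> b * d"
proof (cases "x = 0 \<or> y = 0")
  case True
  \<comment> \<open>If \<open>x = 0\<close> then \<open>y > 0\<close>, and
    \<open>c * y \<le> 0\<close> forces \<open>c = 0\<close>; symmetrically for
    \<open>y = 0\<close>.\<close>
  then have "a = 0 \<or> c = 0"
    using assms by (auto simp: mult_le_0_iff)
  then show ?thesis using assms by auto
next
  case False
  then have "0 < x * y" using assms by simp
  have "(a * x) * (c * y) \<le> (b * y) * (d * x)"
    by (rule mult_mono) (use assms in auto)
  then have "(a * c) * (x * y) \<le> (b * d) * (x * y)"
    by (simp add: mult_ac)
  then show ?thesis using \<open>0 < x * y\<close> by (rule mult_right_le_imp_le)
qed

section \<open>Row estimates for an eigenvector\<close>

lemma eigenvector_row:
  assumes "A \<in> carrier_mat n n" "eigenvector A v z" "k \<in> idx A"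
  shows "(z - A $$ (k,k)) * v $ k = (\<Sum>l\<in>idx A - {k}. A $$ (k,l) * v $ l)"
proof -
  have dim: "v \<in> carrier_vec n" and eq: "A *\<^sub>v v = z \<cdot>\<^sub>v v" and k: "k < n" and N: "idx A = {0..<n}"
    using assms by (auto simp: eigenvector_def idx_def)
  have "z * v $ k = (A *\<^sub>v v) $ k"
    using eq dim k by simp
  also have "\<dots> = (\<Sum>l\<in>idx A. A $$ (k,l) * v $ l)"
    using assms(1) dim k unfolding N by (auto simp: scalar_prod_def intro!: sum.cong)
  also have "\<dots> = A $$ (k,k) * v $ k + (\<Sum>l\<in>idx A - {k}. A $$ (k,l) * v $ l)"
    using k by (intro sum.remove) (auto simp: N)
  finally show ?thesis by (simp add: algebra_simps)
qed

lemma eigenvector_row_diag_le: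
  assumes "A \<in> carrier_mat n n" "eigenvector A v z" "k \<in> idx A"
  shows "cmod (z - A $$ (k,k)) * cmod (v $ k)
    \<le> (\<Sum>l\<in>idx A - {k}. cmod (A $$ (k,l)) * cmod (v $ l))"
proof -
  have "cmod (z - A $$ (k,k)) * cmod (v $ k) = cmod (\<Sum>l\<in>idx A - {k}. A $$ (k,l) * v $ l)"
    using eigenvector_row[OF assms] by (metis norm_mult)
  also have "\<dots> \<le> (\<Sum>l\<in>idx A - {k}. cmod (A $$ (k,l) * v $ l))"
    by (rule norm_sum)
  finally show ?thesis by (simp add: norm_mult)
qed

text \<open>Solve the row for the term of \<open>m\<close>. Adding its modulus to both sides
  completes the remaining sum to the full off-diagonal sum, hence the factor 2.\<close>

lemma eigenvector_row_offdiag_le: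
  assumes "A \<in> carrier_mat n n" "eigenvector A v z" "k \<in> idx A" "m \<in> idx A - {k}"
  shows "2 * cmod (A $$ (k,m)) * cmod (v $ m) \<le> cmod (z - A $$ (k,k)) * cmod (v $ k)
    + (\<Sum>l\<in>idx A - {k}. cmod (A $$ (k,l)) * cmod (v $ l))"
proof -
  let ?R = "idx A - {k} - {m}"
  have fin: "finite (idx A - {k})" by (simp add: idx_def)
  have "A $$ (k,m) * v $ m = (z - A $$ (k,k)) * v $ k - (\<Sum>l\<in>?R. A $$ (k,l) * v $ l)"
    using eigenvector_row[OF assms(1-3)]
      sum.remove[OF fin assms(4), of "\<lambda>l. A $$ (k,l) * v $ l"] by simp
  then have "cmod (A $$ (k,m) * v $ m)
      \<le> cmod ((z - A $$ (k,k)) * v $ k) + cmod (\<Sum>l\<in>?R. A $$ (k,l) * v $ l)"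
    by (simp add: norm_triangle_ineq4)
  also have "\<dots> \<le> cmod ((z - A $$ (k,k)) * v $ k) + (\<Sum>l\<in>?R. cmod (A $$ (k,l) * v $ l))"
    using norm_sum by simp
  finally show ?thesis
    using sum.remove[OF fin assms(4), of "\<lambda>l. cmod (A $$ (k,l)) * cmod (v $ l)"]
    by (simp add: norm_mult mult_ac)
qed

text \<open>The off-diagonal sum splits along \<open>S\<close> and its complement, and each piece is
  bounded by its own maximal entry. Both claims then arise by collecting the multiples of the two
  maxima.\<close>

lemma eigenvector_row_split:
  assumes A: "A \<in> carrier_mat n n" and v: "eigenvector A v z"
    and S: "S \<subseteq> idx A" and i: "i \<in> S" and j: "j \<in> idx A - S"
    and maxi: "\<And>l. l \<in> S \<Longrightarrow> cmod (v $ l) \<le> cmod (v $ i)"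
    and maxj: "\<And>l. l \<in> idx A - S \<Longrightarrow> cmod (v $ l) \<le> cmod (v $ j)"
  shows "max 0 (cmod (z - A $$ (i,i)) - part_sum A S i) * cmod (v $ i)
      \<le> part_sum A (idx A - S) i * cmod (v $ j)"
    and "max 0 (2 * cmod (A $$ (i,j)) - part_sum A (idx A - S) i) * cmod (v $ j)
      \<le> (cmod (z - A $$ (i,i)) + part_sum A S i) * cmod (v $ i)"
proof -
  let ?f = "\<lambda>l. cmod (A $$ (i,l)) * cmod (v $ l)"
  have i': "i \<in> idx A" and j': "j \<in> idx A - {i}" using S i j by auto
  have "idx A - {i} = (S - {i}) \<union> (idx A - S - {i})" using S by auto
  then have "sum ?f (idx A - {i}) = sum ?f (S - {i}) + sum ?f (idx A - S - {i})"
    using S finite_subset[OF S] by (auto simp: idx_def intro!: sum.union_disjoint)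
  also have "\<dots> \<le> part_sum A S i * cmod (v $ i) + part_sum A (idx A - S) i * cmod (v $ j)"
    by (intro add_mono sum_le_part_sum maxi maxj)
  finally have bound: "sum ?f (idx A - {i})
      \<le> part_sum A S i * cmod (v $ i) + part_sum A (idx A - S) i * cmod (v $ j)" .
  show "max 0 (cmod (z - A $$ (i,i)) - part_sum A S i) * cmod (v $ i)
      \<le> part_sum A (idx A - S) i * cmod (v $ j)"
    using bound eigenvector_row_diag_le[OF A v i']
    by (intro max_zero_mult_le) (auto simp: part_sum_nonneg algebra_simps)
  show "max 0 (2 * cmod (A $$ (i,j)) - part_sum A (idx A - S) i) * cmod (v $ j)
      \<le> (cmod (z - A $$ (i,i)) + part_sum A S i) * cmod (v $ i)"
    using bound eigenvector_row_offdiag_le[OF A v i' j']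
    by (intro max_zero_mult_le) (auto simp: part_sum_nonneg algebra_simps)
qed

lemma eigenvector_nonzero_entry:
  assumes "A \<in> carrier_mat n n" "eigenvector A v z"
  obtains l where "l \<in> idx A" "v $ l \<noteq> 0"
proof -
  have "v \<in> carrier_vec n" "v \<noteq> 0\<^sub>v n" "idx A = {0..<n}"
    using assms by (auto simp: eigenvector_def idx_def)
  then show thesis
    using that by (metis atLeastLessThan_iff carrier_vecD eq_vecI index_zero_vec le0)
qed

lemma ex_max_entry:
  fixes v :: "complex vec"
  assumes "finite T" "T \<noteq> {}"
  obtains i where "i \<in> T" "\<And>l. l \<in> T \<Longrightarrow> cmod (v $ l) \<le> cmod (v $ i)"
proof -
  let ?M = "Max ((\<lambda>l. cmod (v $ l)) ` T)"
  have "?M \<in> (\<lambda>l. cmod (v $ l)) ` T"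
    using assms by (intro Max_in) auto
  then obtain i where i: "i \<in> T" "?M = cmod (v $ i)" by auto
  have "cmod (v $ l) \<le> cmod (v $ i)" if "l \<in> T" for l
    using assms that by (simp flip: i(2))
  with i(1) that show thesis by blast
qed

section \<open>Location of the spectrum\<close>

text \<open>With an empty complement, a single maximal entry \<open>v $ i\<close> remains: row
  \<open>i\<close> yields the disk, and every other row, solved for its term of \<open>i\<close>,
  yields the exclusion.\<close>

lemma spectrum_subset_Omega_set:
  assumes A: "A \<in> carrier_mat n n"
  shows "spectrum A \<subseteq> Omega_set A"
proof
  fix z assume "z \<in> spectrum A"
  then obtain v where v: "eigenvector A v z"
    by (auto simp: spectrum_def eigenvalue_def)
  obtain l where l: "l \<in> idx A" "v $ l \<noteq> 0" using eigenvector_nonzero_entry[OF A v] .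
  have fin: "finite (idx A)" "idx A \<noteq> {}" using l by (auto simp: idx_def)
  obtain i where i: "i \<in> idx A" and maxi: "\<And>l. l \<in> idx A \<Longrightarrow> cmod (v $ l) \<le> cmod (v $ i)"
    using ex_max_entry[OF fin, of v] by blast
  have pos: "0 < cmod (v $ i)" using maxi[OF l(1)] l(2) by auto
  have bound: "(\<Sum>l\<in>idx A - {k}. cmod (A $$ (k,l)) * cmod (v $ l))
      \<le> row_sum A k * cmod (v $ i)" for k
    unfolding part_sum_idx[symmetric] by (rule sum_le_part_sum) (rule maxi)
  have "cmod (z - A $$ (i,i)) * cmod (v $ i) \<le> row_sum A i * cmod (v $ i)"
    using eigenvector_row_diag_le[OF A v i] bound[of i] by simp
  then have "z \<in> Gamma_disk A i"
    using pos by (simp add: Gamma_disk_def)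
  moreover have "z \<notin> Delta_set A i"
  proof -
    have "2 * cmod (A $$ (k,i)) - row_sum A k \<le> cmod (z - A $$ (k,k))" if k: "k \<in> idx A - {i}" for k
    proof -
      have "2 * cmod (A $$ (k,i)) * cmod (v $ i)
          \<le> cmod (z - A $$ (k,k)) * cmod (v $ k) + row_sum A k * cmod (v $ i)"
        using eigenvector_row_offdiag_le[OF A v, of k i] bound[of k] k i by force
      \<comment> \<open>Enlarging \<open>v $ k\<close> to the maximal entry makes
        \<open>cmod (v $ i)\<close> a common factor that cancels.\<close>
      also have "\<dots> \<le> cmod (z - A $$ (k,k)) * cmod (v $ i) + row_sum A k * cmod (v $ i)"
        using k by (intro add_right_mono mult_left_mono maxi) auto
      finally have "(2 * cmod (A $$ (k,i))) * cmod (v $ i)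
          \<le> (cmod (z - A $$ (k,k)) + row_sum A k) * cmod (v $ i)"
        by (simp add: algebra_simps)
      then show ?thesis unfolding mult_le_cancel_right_pos[OF pos] by linarith
    qed
    then show ?thesis by (force simp: Delta_set_def)
  qed
  ultimately show "z \<in> Omega_set A" using i by (auto simp: Omega_set_def)
qed

lemma spectrum_subset_Xi_part:
  assumes A: "A \<in> carrier_mat n n" and S: "S \<noteq> {}" "S \<subseteq> idx A"
  shows "spectrum A \<subseteq> Xi_part A S"
proof (cases "S = idx A")
  case True
  then show ?thesis using spectrum_subset_Omega_set[OF A] by (simp add: Xi_part_def)
next
  case False
  show ?thesis
  proof
    fix z assume "z \<in> spectrum A"
    then obtain v where v: "eigenvector A v z"
      by (auto simp: spectrum_def eigenvalue_def)
    let ?T = "idx A - S"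
    have fin: "finite S" "finite ?T" and T: "?T \<noteq> {}" "?T \<subseteq> idx A" "idx A - ?T = S"
      using S False finite_subset[OF S(2)] by (auto simp: idx_def)
    obtain i where i: "i \<in> S" and maxi: "\<And>l. l \<in> S \<Longrightarrow> cmod (v $ l) \<le> cmod (v $ i)"
      using ex_max_entry[OF fin(1) S(1), of v] by blast
    obtain j where j: "j \<in> ?T" and maxj: "\<And>l. l \<in> ?T \<Longrightarrow> cmod (v $ l) \<le> cmod (v $ j)"
      using ex_max_entry[OF fin(2) T(1), of v] by blast
    obtain l where "l \<in> idx A" "v $ l \<noteq> 0" using eigenvector_nonzero_entry[OF A v] .
    then have nz: "cmod (v $ i) \<noteq> 0 \<or> cmod (v $ j) \<noteq> 0"
      using maxi[of l] maxj[of l] by (cases "l \<in> S") auto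
    note ri = eigenvector_row_split[OF A v S(2) i j maxi maxj]
    \<comment> \<open>The complement takes the role of \<open>S\<close>, with \<open>i\<close> and
      \<open>j\<close> exchanged.\<close>
    have rj: "max 0 (cmod (z - A $$ (j,j)) - part_sum A ?T j) * cmod (v $ j)
        \<le> part_sum A S j * cmod (v $ i)"
      "max 0 (2 * cmod (A $$ (j,i)) - part_sum A S j) * cmod (v $ i)
        \<le> (cmod (z - A $$ (j,j)) + part_sum A ?T j) * cmod (v $ j)"
      using eigenvector_row_split[OF A v T(2) j, of i] i maxi maxj unfolding T(3) by auto
    have "z \<in> W_set A S i j"
      using mult_le_mult_of_cross_bounds[OF ri(1) rj(1)] nz
      by (simp add: W_set_def part_sum_nonneg)
    moreover have "z \<notin> Psi_set A S i j"
      using mult_le_mult_of_cross_bounds[OF ri(2) rj(2)] nz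
      by (auto simp: Psi_set_def part_sum_nonneg not_less)
    ultimately show "z \<in> Xi_part A S" using i j False by (auto simp: Xi_part_def)
  qed
qed

section \<open>Singletons and the Dashnic-Zusmanovich set\<close>

text \<open>The first truncation is vacuous since \<open>part_sum A {i} i = 0\<close>; the second is
  harmless because the right side is nonnegative.\<close>

lemma W_set_singleton:
  assumes "i \<in> idx A" "i \<noteq> j"
  shows "W_set A {i} i j = D_set A i j"
proof -
  have "0 \<le> row_sum A i" using part_sum_nonneg[of A "idx A"] by (simp add: part_sum_idx)
  then have *: "a * max 0 b \<le> row_sum A i * cmod c \<longleftrightarrow> a * b \<le> row_sum A i * cmod c"
    if "0 \<le> a" for a b and c :: complex
  proof (cases "0 \<le> b")
    case False
    then have "a * b \<le> 0" "0 \<le> row_sum A i * cmod c"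
      using that \<open>0 \<le> row_sum A i\<close> by (auto simp: mult_nonneg_nonpos)
    then show ?thesis using False by (simp add: max_def)
  qed simp
  show ?thesis
    unfolding W_set_def D_set_def
    using assms * by (simp add: part_sum_singleton part_sum_self part_sum_remove_self
        part_sum_remove part_sum_idx)
qed

text \<open>The left side is nonnegative, so the strict inequality fails for a nonpositive right
  side, truncated or not. The other factor is
  \<open>2 * cmod (A $$ (j,i)) - cmod (A $$ (j,i))\<close>.\<close>

lemma Psi_set_singleton:
  assumes "i \<in> idx A" "i \<noteq> j"
  shows "Psi_set A {i} i j = L_set A i j"
proof -
  have "0 \<le> row_sum_without A j i"
    using part_sum_nonneg[of A "idx A - {i}" j] assms by (simp add: part_sum_remove)
  then have lhs: "0 \<le> cmod (z - A $$ (i,i)) * (cmod (z - A $$ (j,j)) + row_sum_without A j i)" for z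
    by simp
  have *: "a < max 0 b * cmod c \<longleftrightarrow> a < b * cmod c" if "0 \<le> a" for a b and c :: complex
    using that mult_nonpos_nonneg[of b "cmod c"] by (auto simp: max_def)
  show ?thesis
    unfolding Psi_set_def L_set_def
    using assms by (simp add: part_sum_singleton part_sum_self part_sum_remove_self
        part_sum_remove part_sum_idx *[OF lhs])
qed

text \<open>Assuming \<open>idx A \<noteq> {i}\<close> keeps \<open>Xi_part\<close> out of its
  \<open>Omega_set\<close> branch.\<close>

lemma Xi_part_singleton:
  assumes "i \<in> idx A" "idx A \<noteq> {i}"
  shows "Xi_part A {i} = (\<Union>j\<in>idx A - {i}. D_set A i j - L_set A i j)"
proof -
  have "W_set A {i} i j - Psi_set A {i} i j = D_set A i j - L_set A i j" if "j \<in> idx A - {i}" for j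
    using that assms W_set_singleton[of i A j] Psi_set_singleton[of i A j] by auto
  then show ?thesis using assms by (auto simp: Xi_part_def)
qed

section \<open>Comparison with the CKV set and conclusion\<close>

text \<open>Outside the disk the first factor is positive, so truncating the second can only enlarge
  the product. Inside it, two negative factors may have too large a product for
  \<open>V_set\<close>.\<close>

lemma W_set_subset: "W_set A S i j \<subseteq> Gamma_part A S i \<union> V_set A S i j"
proof
  fix z assume z: "z \<in> W_set A S i j"
  let ?a = "cmod (z - A $$ (i,i)) - part_sum A S i"
  let ?b = "cmod (z - A $$ (j,j)) - part_sum A (idx A - S) j"
  show "z \<in> Gamma_part A S i \<union> V_set A S i j"
  proof (cases "?a \<le> 0")
    case True
    then show ?thesis by (simp add: Gamma_part_def)
  next
    case False
    then have "?a * ?b \<le> max 0 ?a * max 0 ?b"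
      by (simp add: mult_left_mono)
    with z show ?thesis by (auto simp: W_set_def V_set_def)
  qed
qed

lemma Xi_part_subset_CKV_part: "Xi_part A S \<subseteq> CKV_part A S"
proof (cases "S = idx A")
  case True
  then show ?thesis
    by (auto simp: Xi_part_def CKV_part_def Omega_set_def Gamma_disk_def Gamma_part_def part_sum_idx)
next
  case False
  have "W_set A S i j - Psi_set A S i j \<subseteq> CKV_part A S" if "i \<in> S" "j \<in> idx A - S" for i j
    using W_set_subset[of A S i j] that unfolding CKV_part_def by blast
  then show ?thesis using False unfolding Xi_part_def by (simp add: UN_subset_iff)
qed

theorem mainTheorem3:
  fixes n :: nat and A :: "complex mat"
  assumes "n \<ge> 2" and "A \<in> carrier_mat n n"
  shows "(\<forall>i\<in>{0..<n}. Xi_part A {i} = (\<Union>j\<in>{0..<n} - {i}. D_set A i j - L_set A i j))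
    \<and> (\<Inter>i\<in>{0..<n}. Xi_part A {i}) = Theta_set A
    \<and> spectrum A \<subseteq> Xi_set A
    \<and> Xi_set A \<subseteq> Theta_set A
    \<and> Xi_set A \<subseteq> Omega_set A
    \<and> Xi_set A \<subseteq> CKV_set A"
proof -
  have N: "idx A = {0..<n}" using assms(2) by (simp add: idx_def)
  have "card (idx A) \<noteq> 1" using assms(1) by (simp add: N)
  then have "idx A \<noteq> {i}" for i by auto
  then have single: "\<forall>i\<in>{0..<n}. Xi_part A {i} = (\<Union>j\<in>{0..<n} - {i}. D_set A i j - L_set A i j)"
    using Xi_part_singleton[of _ A] by (simp add: N)
  then have theta: "(\<Inter>i\<in>{0..<n}. Xi_part A {i}) = Theta_set A"
    by (simp add: Theta_set_def N)
  have "spectrum A \<subseteq> Xi_set A"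
    unfolding Xi_set_def using spectrum_subset_Xi_part[OF assms(2)] by blast
  \<comment> \<open>Among the sets intersected in \<open>Xi_set\<close>, the singletons give
    \<open>Theta_set\<close> and \<open>idx A\<close> itself gives \<open>Omega_set\<close>.\<close>
  moreover have "Xi_set A \<subseteq> Theta_set A"
    unfolding theta[symmetric] Xi_set_def N by auto
  moreover have "Xi_set A \<subseteq> Xi_part A (idx A)"
    unfolding Xi_set_def using assms(1) by (auto simp: N)
  then have "Xi_set A \<subseteq> Omega_set A"
    by (simp add: Xi_part_def)
  moreover have "Xi_set A \<subseteq> CKV_set A"
    unfolding Xi_set_def CKV_set_def using Xi_part_subset_CKV_part by (intro INT_anti_mono) auto
  ultimately show ?thesis using single theta by blast
qed

end
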